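(* Let $k\ge 1$ and let $A_i,B_{i1},\ldots,B_{ik}\in\mathbb{C}^{m_i\times n_i}$ with $m_i\ge n_i$ for $1\le i\le k$. Define $$\theta_1:=\inf \sum_{i=1}^k\big\|\big[\widehat A_i-A_i,\ \widehat B_{i1}-B_{i1},\ \ldots,\ \widehat B_{ik}-B_{ik}\big]\big\|_{F}^2,$$ where the infimum is over all matrices $\widehat A_i,\widehat B_{is}\in\mathbb{C}^{m_i\times n_i}$ ($1\le i,s\le k$), all scalars $\lambda_1,\ldots,\lambda_k\in\mathbb{C}$ and all vectors $\mathbf{x}_i\in\mathbb{C}^{n_i}$ with $\|\mathbf{x}_i\|_2=1$ ($1\le i\le k$) such that $$\widehat A_i\mathbf{x}_i=\sum_{s=1}^k\lambda_s\widehat B_{is}\mathbf{x}_i\quad\text{for } 1\le i\le k.$$ Then $$\theta_1=\inf\ \frac{\sum_{i=1}^k\big\|A_i\mathbf{x}_i-\sum_{s=1}^k\lambda_sB_{is}\mathbf{x}_i\big\|_2^2}{1+\sum_{i=1}^k|\lambda_i|^2},$$ where the infimum is over all $\lambda_1,\ldots,\lambda_k\in\mathbb{C}$ and all $\mathbf{x}_i\in\mathbb{C}^{n_i}$ with $\|\mathbf{x}_i\|_2=1$ for $1\le i\le k$.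
   Context: $\|\cdot\|_F$ is the Frobenius norm, $\|\cdot\|_2$ the Euclidean vector norm, and $[M_0,M_1,\ldots,M_k]$ denotes horizontal concatenation of matrices with the same number of rows. *)

theory Defs
  imports Complex_Main "Jordan_Normal_Form.Matrix"
begin

definition vec_norm2 :: "complex vec \<Rightarrow> real" where
  "vec_norm2 v = sqrt (\<Sum>j<dim_vec v. (cmod (v $ j))\<^sup>2)"

definition frobenius_norm :: "complex mat \<Rightarrow> real" where
  "frobenius_norm M = sqrt (\<Sum>i<dim_row M. \<Sum>j<dim_col M. (cmod (M $$ (i, j)))\<^sup>2)"

text \<open>Horizontal concatenation of matrices that all have \<open>r\<close> rows.\<close>

definition hconcat :: "nat \<Rightarrow> complex mat list \<Rightarrow> complex mat" where
  "hconcat r Ms = mat_of_cols r (concat (map cols Ms))"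

definition unit_vec_family :: "nat \<Rightarrow> (nat \<Rightarrow> nat) \<Rightarrow> (nat \<Rightarrow> complex vec) \<Rightarrow> bool" where
  "unit_vec_family k n x \<longleftrightarrow> (\<forall>i\<in>{1..k}. x i \<in> carrier_vec (n i) \<and> vec_norm2 (x i) = 1)"

definition mat_family ::
  "nat \<Rightarrow> (nat \<Rightarrow> nat) \<Rightarrow> (nat \<Rightarrow> nat) \<Rightarrow> (nat \<Rightarrow> complex mat) \<Rightarrow> (nat \<Rightarrow> nat \<Rightarrow> complex mat) \<Rightarrow> bool"
where
  "mat_family k m n A B \<longleftrightarrow>
    (\<forall>i\<in>{1..k}. A i \<in> carrier_mat (m i) (n i) \<and>
      (\<forall>s\<in>{1..k}. B i s \<in> carrier_mat (m i) (n i)))"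

text \<open>The vector \<open>\<lambda>\<^sub>1 B\<^sub>1 x + \<dots> + \<lambda>\<^sub>k B\<^sub>k x\<close> with \<open>r\<close> entries.\<close>

definition lincomb_vec ::
  "nat \<Rightarrow> nat \<Rightarrow> (nat \<Rightarrow> complex) \<Rightarrow> (nat \<Rightarrow> complex mat) \<Rightarrow> complex vec \<Rightarrow> complex vec" where
  "lincomb_vec k r l Bs x = finsum_vec TYPE(complex) r (\<lambda>s. l s \<cdot>\<^sub>v (Bs s *\<^sub>v x)) {1..k}"

text \<open>The infimum is taken in the reals. The set is bounded below by \<open>0\<close>, and it is nonempty
  whenever \<open>n i \<ge> 1\<close> for all \<open>i \<in> {1..k}\<close> (take all perturbed matrices to be \<open>0\<close>). Families
  are functions on \<open>nat\<close>; only their values at indices in \<open>{1..k}\<close> matter.\<close>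

definition theta1 ::
  "nat \<Rightarrow> (nat \<Rightarrow> nat) \<Rightarrow> (nat \<Rightarrow> nat) \<Rightarrow> (nat \<Rightarrow> complex mat) \<Rightarrow> (nat \<Rightarrow> nat \<Rightarrow> complex mat) \<Rightarrow> real"
where
  "theta1 k m n A B = Inf
    {\<Sum>i=1..k. (frobenius_norm
        (hconcat (m i) ((A' i - A i) # map (\<lambda>s. B' i s - B i s) [1..<Suc k])))\<^sup>2
     | A' B' l x.
       mat_family k m n A' B' \<and> unit_vec_family k n x \<and>
       (\<forall>i\<in>{1..k}. A' i *\<^sub>v x i = lincomb_vec k (m i) l (B' i) (x i))}"

end

theory Submission
  imports Defs "HOL-Analysis.Convex"
begin

text \<open>Put \<open>r i = A i x i - (\<Sum>s. l s B i s x i)\<close> and \<open>L = 1 + (\<Sum>s. |l s|\<^sup>2)\<close>. A perturbation \<open>E i, F i s\<close> is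
  feasible iff \<open>(E i - (\<Sum>s. l s F i s)) x i = - r i\<close>, so the Cauchy--Schwarz inequality bounds its
  squared Frobenius norm below by \<open>|r i|\<^sup>2 / L\<close>. The rank-one choice
  \<open>E i = - r i x i\<^sup>* / L\<close>, \<open>F i s = cnj (l s) r i x i\<^sup>* / L\<close> is feasible and attains this bound.\<close>

section \<open>Frobenius norms of concatenated matrices\<close>

lemma vec_norm2_sq: "(vec_norm2 v)\<^sup>2 = (\<Sum>j<dim_vec v. (cmod (v $ j))\<^sup>2)"
  unfolding vec_norm2_def by (simp add: sum_nonneg)

lemma frobenius_norm_sq:
  "(frobenius_norm M)\<^sup>2 = (\<Sum>i<dim_row M. \<Sum>j<dim_col M. (cmod (M $$ (i, j)))\<^sup>2)"
  unfolding frobenius_norm_def by (simp add: sum_nonneg)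

text \<open>Exchanging the order of summation groups the entries by columns, the form suited to
  \<open>hconcat\<close>, which is built from a list of columns.\<close>

lemma frobenius_norm_sq_cols:
  "(frobenius_norm M)\<^sup>2 = sum_list (map (\<lambda>v. (vec_norm2 v)\<^sup>2) (cols M))"
proof -
  have "(frobenius_norm M)\<^sup>2 = (\<Sum>j<dim_col M. \<Sum>i<dim_row M. (cmod (M $$ (i, j)))\<^sup>2)"
    unfolding frobenius_norm_sq by (rule sum.swap)
  also have "\<dots> = (\<Sum>j<dim_col M. (vec_norm2 (col M j))\<^sup>2)"
    by (simp add: vec_norm2_sq)
  also have "\<dots> = sum_list (map (\<lambda>v. (vec_norm2 v)\<^sup>2) (cols M))"
    by (simp add: cols_def o_def interv_sum_list_conv_sum_set_nat atLeast0LessThan)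
  finally show ?thesis .
qed

text \<open>The columns of a concatenation are the concatenated columns of the blocks. The common
  row count puts them all in \<open>carrier_vec r\<close>, so that \<open>mat_of_cols\<close> keeps
  them unchanged.\<close>

lemma frobenius_norm_hconcat_sq:
  assumes "\<And>M. M \<in> set Ms \<Longrightarrow> dim_row M = r"
  shows "(frobenius_norm (hconcat r Ms))\<^sup>2 = (\<Sum>M\<leftarrow>Ms. (frobenius_norm M)\<^sup>2)"
proof -
  have "set (concat (map cols Ms)) \<subseteq> carrier_vec r"
    using assms by (auto simp: cols_def intro!: carrier_vecI)
  then have "(frobenius_norm (hconcat r Ms))\<^sup>2
      = sum_list (map (\<lambda>v. (vec_norm2 v)\<^sup>2) (concat (map cols Ms)))"
    unfolding frobenius_norm_sq_cols hconcat_def by (simp only: cols_mat_of_cols)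
  also have "\<dots> = (\<Sum>M\<leftarrow>Ms. (frobenius_norm M)\<^sup>2)"
    by (induction Ms) (simp_all add: frobenius_norm_sq_cols)
  finally show ?thesis .
qed

text \<open>The sum over \<open>s\<close> is moved innermost, so that the Cauchy-Schwarz inequality
  in \<open>s\<close> can be applied at each entry position separately.\<close>

lemma frobenius_norm_hconcat_Cons_sq:
  assumes "E \<in> carrier_mat r c" and "F \<in> {1..k} \<rightarrow> carrier_mat r c"
  shows "(frobenius_norm (hconcat r (E # map F [1..<Suc k])))\<^sup>2
    = (\<Sum>a<r. \<Sum>j<c. (cmod (E $$ (a, j)))\<^sup>2 + (\<Sum>s=1..k. (cmod (F s $$ (a, j)))\<^sup>2))"
proof -
  have "(frobenius_norm (hconcat r (E # map F [1..<Suc k])))\<^sup>2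
      = (frobenius_norm E)\<^sup>2 + (\<Sum>s=1..k. (frobenius_norm (F s))\<^sup>2)"
    using carrier_matD(1)[OF assms(1)] carrier_matD(1)[OF funcset_mem[OF assms(2)]]
    by (subst frobenius_norm_hconcat_sq)
      (auto simp: interv_sum_list_conv_sum_set_nat o_def atLeastLessThanSuc_atLeastAtMost
        simp del: upt_Suc)
  also have "(\<Sum>s=1..k. (frobenius_norm (F s))\<^sup>2)
      = (\<Sum>s=1..k. \<Sum>a<r. \<Sum>j<c. (cmod (F s $$ (a, j)))\<^sup>2)"
  proof (rule sum.cong)
    fix s assume "s \<in> {1..k}"
    from funcset_mem[OF assms(2) this] show "(frobenius_norm (F s))\<^sup>2 = (\<Sum>a<r. \<Sum>j<c. (cmod (F s $$ (a, j)))\<^sup>2)"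
      unfolding frobenius_norm_sq by auto
  qed simp
  also have "\<dots> = (\<Sum>a<r. \<Sum>s=1..k. \<Sum>j<c. (cmod (F s $$ (a, j)))\<^sup>2)"
    by (rule sum.swap)
  also have "\<dots> = (\<Sum>a<r. \<Sum>j<c. \<Sum>s=1..k. (cmod (F s $$ (a, j)))\<^sup>2)"
    by (rule sum.cong[OF refl], rule sum.swap)
  finally show ?thesis
    using assms(1) by (simp add: frobenius_norm_sq sum.distrib)
qed

section \<open>Entries of the residual vector\<close>

lemma lincomb_vec_carrier:
  assumes "Bs \<in> {1..k} \<rightarrow> carrier_mat r c"
  shows "lincomb_vec k r l Bs x \<in> carrier_vec r"
  unfolding lincomb_vec_def using carrier_matD(1)[OF funcset_mem[OF assms]]
  by (intro finsum_vec_closed) (auto simp: Pi_iff intro!: carrier_vecI)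

text \<open>Congruence for the underlying monoid product asks that the summands on one side lie in
  the carrier; the dimensions of \<open>Cs\<close> provide this.\<close>

lemma lincomb_vec_cong:
  assumes "Cs \<in> {1..k} \<rightarrow> carrier_mat r c" and "\<And>s. s \<in> {1..k} \<Longrightarrow> Bs s = Cs s"
  shows "lincomb_vec k r l Bs x = lincomb_vec k r l Cs x"
  unfolding lincomb_vec_def finsum_vec_def
  using assms(2) carrier_matD(1)[OF funcset_mem[OF assms(1)]]
  by (intro comm_monoid.finprod_cong'[OF comm_monoid_vec])
    (auto simp: monoid_vec_simps intro!: carrier_vecI)

lemma index_mult_mat_vec_sum:
  assumes "M \<in> carrier_mat r c" "x \<in> carrier_vec c" "a < r"
  shows "(M *\<^sub>v x) $ a = (\<Sum>j<c. M $$ (a, j) * x $ j)"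
  using assms by (auto simp: scalar_prod_def atLeast0LessThan)

lemma index_lincomb_vec:
  assumes "Bs \<in> {1..k} \<rightarrow> carrier_mat r c" "x \<in> carrier_vec c" "a < r"
  shows "lincomb_vec k r l Bs x $ a = (\<Sum>j<c. (\<Sum>s=1..k. l s * Bs s $$ (a, j)) * x $ j)"
proof -
  have "lincomb_vec k r l Bs x $ a = (\<Sum>s=1..k. (l s \<cdot>\<^sub>v (Bs s *\<^sub>v x)) $ a)"
    unfolding lincomb_vec_def using carrier_matD(1)[OF funcset_mem[OF assms(1)]] assms(3)
    by (intro index_finsum_vec) (auto simp: Pi_iff intro!: carrier_vecI)
  also have "\<dots> = (\<Sum>s=1..k. \<Sum>j<c. l s * Bs s $$ (a, j) * x $ j)"
  proof (rule sum.cong)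
    fix s assume "s \<in> {1..k}"
    from funcset_mem[OF assms(1) this] assms(2,3)
    show "(l s \<cdot>\<^sub>v (Bs s *\<^sub>v x)) $ a = (\<Sum>j<c. l s * Bs s $$ (a, j) * x $ j)"
      by (auto simp: scalar_prod_def atLeast0LessThan sum_distrib_left mult.assoc)
  qed simp
  also have "\<dots> = (\<Sum>j<c. (\<Sum>s=1..k. l s * Bs s $$ (a, j)) * x $ j)"
    by (subst sum.swap) (simp add: sum_distrib_right)
  finally show ?thesis .
qed

text \<open>For fixed \<open>l\<close>, the residual is one matrix, \<open>E\<close> minus the
  combination of the \<open>F s\<close>, applied to \<open>x\<close>. This lets the sums over
  \<open>j\<close> and over \<open>s\<close> be estimated one after the other.\<close>

lemma index_residual:
  assumes "E \<in> carrier_mat r c" "F \<in> {1..k} \<rightarrow> carrier_mat r c"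
    and "x \<in> carrier_vec c" "a < r"
  shows "(E *\<^sub>v x - lincomb_vec k r l F x) $ a
    = (\<Sum>j<c. (E $$ (a, j) - (\<Sum>s=1..k. l s * F s $$ (a, j))) * x $ j)"
proof -
  have "lincomb_vec k r l F x \<in> carrier_vec r"
    by (rule lincomb_vec_carrier[OF assms(2)])
  with assms(4)
  have "(E *\<^sub>v x - lincomb_vec k r l F x) $ a = (E *\<^sub>v x) $ a - lincomb_vec k r l F x $ a"
    by (simp del: index_mult_mat_vec)
  then show ?thesis
    unfolding index_mult_mat_vec_sum[OF assms(1,3,4)]
      index_lincomb_vec[OF assms(2-4)]
    by (simp only: left_diff_distrib sum_subtractf)
qed

section \<open>Lower bound from the Cauchy-Schwarz inequality\<close>

text \<open>The triangle inequality passes to moduli, where the real Cauchy-Schwarz inequality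
  applies.\<close>

lemma cmod_sum_mult_sq_le:
  "(cmod (\<Sum>i\<in>I. f i * g i))\<^sup>2 \<le> (\<Sum>i\<in>I. (cmod (f i))\<^sup>2) * (\<Sum>i\<in>I. (cmod (g i))\<^sup>2)"
proof -
  have "cmod (\<Sum>i\<in>I. f i * g i) \<le> (\<Sum>i\<in>I. cmod (f i) * cmod (g i))"
    by (rule sum_norm_le) (simp add: norm_mult)
  then have "(cmod (\<Sum>i\<in>I. f i * g i))\<^sup>2 \<le> (\<Sum>i\<in>I. cmod (f i) * cmod (g i))\<^sup>2"
    by (rule power_mono) simp
  also have "\<dots> \<le> (\<Sum>i\<in>I. (cmod (f i))\<^sup>2) * (\<Sum>i\<in>I. (cmod (g i))\<^sup>2)"
    by (rule Cauchy_Schwarz_ineq_sum)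
  finally show ?thesis .
qed

lemma cmod_diff_sum_mult_sq_le:
  fixes e :: complex and k :: nat
  shows "(cmod (e - (\<Sum>s=1..k. l s * f s)))\<^sup>2
    \<le> (1 + (\<Sum>s=1..k. (cmod (l s))\<^sup>2)) * ((cmod e)\<^sup>2 + (\<Sum>s=1..k. (cmod (f s))\<^sup>2))"
  \<comment> \<open>The free index 0 holds the extra term: the weights are
    \<open>1, l 1, ..., l k\<close> and the entries \<open>e, - f 1, ..., - f k\<close>.\<close>
  using cmod_sum_mult_sq_le[of "l(0 := 1)" "\<lambda>s. if s = 0 then e else - f s" "{0..k}"]
  by (simp add: sum.atLeast_Suc_atMost sum_negf)

text \<open>Cauchy-Schwarz is used twice: over \<open>j\<close> against \<open>x\<close>, whose norm
  1 leaves no factor, and then at each entry over \<open>s\<close> against the weights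
  \<open>1, l 1, ..., l k\<close>, which gives the factor \<open>?L\<close>.\<close>

lemma residual_norm_sq_le:
  assumes "E \<in> carrier_mat r c" "F \<in> {1..k} \<rightarrow> carrier_mat r c"
    and "x \<in> carrier_vec c" "vec_norm2 x = 1"
  shows "(vec_norm2 (E *\<^sub>v x - lincomb_vec k r l F x))\<^sup>2
    \<le> (1 + (\<Sum>s=1..k. (cmod (l s))\<^sup>2)) * (frobenius_norm (hconcat r (E # map F [1..<Suc k])))\<^sup>2"
proof -
  let ?L = "1 + (\<Sum>s=1..k. (cmod (l s))\<^sup>2)"
  have x1: "(\<Sum>j<c. (cmod (x $ j))\<^sup>2) = 1"
    using assms(3,4) vec_norm2_sq[of x] by auto
  have "dim_vec (E *\<^sub>v x - lincomb_vec k r l F x) = r"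
    using lincomb_vec_carrier[OF assms(2)] by auto
  then have "(vec_norm2 (E *\<^sub>v x - lincomb_vec k r l F x))\<^sup>2
      = (\<Sum>a<r. (cmod (\<Sum>j<c. (E $$ (a, j) - (\<Sum>s=1..k. l s * F s $$ (a, j))) * x $ j))\<^sup>2)"
    unfolding vec_norm2_sq using index_residual[OF assms(1-3)]
    by (simp del: index_minus_vec(1) One_nat_def)
  also have "\<dots> \<le> (\<Sum>a<r. \<Sum>j<c. (cmod (E $$ (a, j) - (\<Sum>s=1..k. l s * F s $$ (a, j))))\<^sup>2)"
    by (rule sum_mono, rule order_trans[OF cmod_sum_mult_sq_le]) (simp add: x1)
  also have "\<dots> \<le> (\<Sum>a<r. \<Sum>j<c.
      ?L * ((cmod (E $$ (a, j)))\<^sup>2 + (\<Sum>s=1..k. (cmod (F s $$ (a, j)))\<^sup>2)))"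
    by (intro sum_mono cmod_diff_sum_mult_sq_le)
  also have "\<dots> = ?L * (frobenius_norm (hconcat r (E # map F [1..<Suc k])))\<^sup>2"
    unfolding frobenius_norm_hconcat_Cons_sq[OF assms(1,2)]
    by (simp only: sum_distrib_left)
  finally show ?thesis .
qed

section \<open>A rank-one perturbation attaining the bound\<close>

text \<open>This is the equality case of both Cauchy-Schwarz steps: each row is a multiple of the
  conjugate of \<open>x\<close>, and \<open>E, - F 1, ..., - F k\<close> are proportional to the
  conjugates of \<open>1, l 1, ..., l k\<close>. Division by \<open>L\<close> normalises the
  residual to \<open>y\<close>.\<close>

lemma rank_one_perturbation:
  fixes x y :: "complex vec" and l :: "nat \<Rightarrow> complex" and k :: nat
  assumes "x \<in> carrier_vec c" "vec_norm2 x = 1" "y \<in> carrier_vec r"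
  defines "L \<equiv> 1 + (\<Sum>s=1..k. (cmod (l s))\<^sup>2)"
  defines "E \<equiv> mat r c (\<lambda>(a, j). y $ a * cnj (x $ j) / of_real L)"
    and "F \<equiv> \<lambda>s. mat r c (\<lambda>(a, j). - cnj (l s) * y $ a * cnj (x $ j) / of_real L)"
  shows "E *\<^sub>v x - lincomb_vec k r l F x = y"
    and "(frobenius_norm (hconcat r (E # map F [1..<Suc k])))\<^sup>2 = (vec_norm2 y)\<^sup>2 / L"
proof -
  have L: "L > 0"
    unfolding L_def by (intro add_pos_nonneg sum_nonneg) auto
  then have L0: "complex_of_real L \<noteq> 0"
    by simp
  have L_complex: "1 + (\<Sum>s=1..k. l s * cnj (l s)) = complex_of_real L"
    unfolding L_def by (simp only: of_real_add of_real_sum of_real_1 complex_norm_square)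
  have x1: "(\<Sum>j<c. (cmod (x $ j))\<^sup>2) = 1"
    using assms(1,2) vec_norm2_sq[of x] by auto
  have x1_complex: "(\<Sum>j<c. cnj (x $ j) * x $ j) = 1"
    using arg_cong[OF x1, of complex_of_real]
    by (simp only: of_real_sum of_real_1 complex_norm_square mult.commute)
  have E: "E \<in> carrier_mat r c" and F: "F \<in> {1..k} \<rightarrow> carrier_mat r c"
    by (auto simp: E_def F_def)
  show "E *\<^sub>v x - lincomb_vec k r l F x = y"
  proof (rule eq_vecI)
    fix a assume "a < dim_vec y"
    then have a: "a < r" using assms(3) by auto
    have "E $$ (a, j) - (\<Sum>s=1..k. l s * F s $$ (a, j)) = y $ a * cnj (x $ j)" if "j < c" for j
    proof -
      \<comment> \<open>Each term \<open>l s * F s\<close> contributes minus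
        \<open>l s * cnj (l s)\<close>, so the subtraction adds up the factor \<open>L\<close>,
        which then cancels the denominator.\<close>
      have "E $$ (a, j) - (\<Sum>s=1..k. l s * F s $$ (a, j))
          = (1 + (\<Sum>s=1..k. l s * cnj (l s))) * (y $ a * cnj (x $ j) / of_real L)"
        using a that
        by (simp add: E_def F_def sum_negf sum_divide_distrib add_divide_distrib distrib_right sum_distrib_right
            mult.assoc)
      then show ?thesis
        using L0 by (simp add: L_complex del: One_nat_def)
    qed
    then have "(E *\<^sub>v x - lincomb_vec k r l F x) $ a = (\<Sum>j<c. y $ a * cnj (x $ j) * x $ j)"
      using index_residual[OF E F assms(1) a] by simp
    also have "\<dots> = y $ a"
      using x1_complex by (simp add: mult.assoc flip: sum_distrib_left)
    finally show "(E *\<^sub>v x - lincomb_vec k r l F x) $ a = y $ a" .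
  next
    show "dim_vec (E *\<^sub>v x - lincomb_vec k r l F x) = dim_vec y"
      using lincomb_vec_carrier[OF F] assms(3) by auto
  qed
  have "(cmod (E $$ (a, j)))\<^sup>2 + (\<Sum>s=1..k. (cmod (F s $$ (a, j)))\<^sup>2)
      = (cmod (y $ a))\<^sup>2 / L * (cmod (x $ j))\<^sup>2" if "a < r" "j < c" for a j
  proof -
    \<comment> \<open>Squaring produces \<open>L\<close> squared in the denominator, while summing
      the squared weights gives one factor \<open>L\<close> above it; a single \<open>1 / L\<close>
      remains.\<close>
    have "(cmod (E $$ (a, j)))\<^sup>2 + (\<Sum>s=1..k. (cmod (F s $$ (a, j)))\<^sup>2)
        = (1 + (\<Sum>s=1..k. (cmod (l s))\<^sup>2)) * ((cmod (y $ a))\<^sup>2 * (cmod (x $ j))\<^sup>2 / L\<^sup>2)"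
      using that
      by (simp add: E_def F_def norm_mult norm_divide power_mult_distrib power_divide
          distrib_right sum_distrib_right sum_divide_distrib add_divide_distrib mult.assoc)
    then show ?thesis
      using L unfolding L_def[symmetric] by (simp add: power2_eq_square)
  qed
  then have "(frobenius_norm (hconcat r (E # map F [1..<Suc k])))\<^sup>2
      = (\<Sum>a<r. \<Sum>j<c. (cmod (y $ a))\<^sup>2 / L * (cmod (x $ j))\<^sup>2)"
    unfolding frobenius_norm_hconcat_Cons_sq[OF E F] by simp
  also have "\<dots> = (vec_norm2 y)\<^sup>2 / L"
    using assms(3) by (simp only: x1 mult_1_right vec_norm2_sq carrier_vecD flip: sum_distrib_left sum_divide_distrib)
  finally show "(frobenius_norm (hconcat r (E # map F [1..<Suc k])))\<^sup>2 = (vec_norm2 y)\<^sup>2 / L" .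
qed

section \<open>Linearity of the residual in the matrices\<close>

text \<open>With \<open>l\<close> and \<open>x\<close> fixed, the residual is linear in the
  matrices. Feasibility of the perturbed data thus becomes a condition on the perturbation
  alone.\<close>

lemma residual_diff:
  assumes "E \<in> carrier_mat r c" "E' \<in> carrier_mat r c"
    and "F \<in> {1..k} \<rightarrow> carrier_mat r c"
    and "F' \<in> {1..k} \<rightarrow> carrier_mat r c"
    and "x \<in> carrier_vec c"
  shows "(E' - E) *\<^sub>v x - lincomb_vec k r l (\<lambda>s. F' s - F s) x
    = (E' *\<^sub>v x - lincomb_vec k r l F' x) - (E *\<^sub>v x - lincomb_vec k r l F x)"
proof (rule eq_vecI)
  let ?D = "\<lambda>s. F' s - F s"
  have D: "?D \<in> {1..k} \<rightarrow> carrier_mat r c"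
    using assms(3,4) by (auto intro!: minus_carrier_mat)
  have dims: "dim_vec (lincomb_vec k r l ?D x) = r" "dim_vec (lincomb_vec k r l F x) = r"
    "dim_vec (lincomb_vec k r l F' x) = r"
    using lincomb_vec_carrier[OF D] lincomb_vec_carrier[OF assms(3)]
      lincomb_vec_carrier[OF assms(4)] by auto
  show "dim_vec ((E' - E) *\<^sub>v x - lincomb_vec k r l ?D x)
      = dim_vec ((E' *\<^sub>v x - lincomb_vec k r l F' x) - (E *\<^sub>v x - lincomb_vec k r l F x))"
    by (simp add: dims)
  fix a assume "a < dim_vec ((E' *\<^sub>v x - lincomb_vec k r l F' x) - (E *\<^sub>v x - lincomb_vec k r l F x))"
  then have a: "a < r" by (simp add: dims)
  have F_index: "(\<Sum>s=1..k. l s * ?D s $$ (a, j))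
      = (\<Sum>s=1..k. l s * F' s $$ (a, j)) - (\<Sum>s=1..k. l s * F s $$ (a, j))" if "j < c" for j
    unfolding sum_subtractf[symmetric]
  proof (rule sum.cong)
    fix s assume "s \<in> {1..k}"
    from funcset_mem[OF assms(3) this] a that
    show "l s * ?D s $$ (a, j) = l s * F' s $$ (a, j) - l s * F s $$ (a, j)"
      by (auto simp: algebra_simps)
  qed simp
  have "((E' - E) *\<^sub>v x - lincomb_vec k r l ?D x) $ a
      = (\<Sum>j<c. ((E' - E) $$ (a, j) - (\<Sum>s=1..k. l s * ?D s $$ (a, j))) * x $ j)"
    by (rule index_residual[OF minus_carrier_mat[OF assms(1)] D assms(5) a])
  also have "\<dots> = (\<Sum>j<c. (E' $$ (a, j) - (\<Sum>s=1..k. l s * F' s $$ (a, j))) * x $ j)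
      - (\<Sum>j<c. (E $$ (a, j) - (\<Sum>s=1..k. l s * F s $$ (a, j))) * x $ j)"
    unfolding sum_subtractf[symmetric]
  proof (rule sum.cong)
    fix j assume "j \<in> {..<c}"
    then have j: "j < c" by simp
    then have "(E' - E) $$ (a, j) = E' $$ (a, j) - E $$ (a, j)"
      using assms(1) a by simp
    then show "((E' - E) $$ (a, j) - (\<Sum>s=1..k. l s * ?D s $$ (a, j))) * x $ j
        = (E' $$ (a, j) - (\<Sum>s=1..k. l s * F' s $$ (a, j))) * x $ j
          - (E $$ (a, j) - (\<Sum>s=1..k. l s * F s $$ (a, j))) * x $ j"
      unfolding F_index[OF j] by (simp only: left_diff_distrib) simp
  qed simp
  also have "\<dots> = (E' *\<^sub>v x - lincomb_vec k r l F' x) $ a - (E *\<^sub>v x - lincomb_vec k r l F x) $ a"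
    by (simp only: index_residual[OF assms(1,3,5) a] index_residual[OF assms(2,4,5) a])
  also have "\<dots> = ((E' *\<^sub>v x - lincomb_vec k r l F' x) - (E *\<^sub>v x - lincomb_vec k r l F x)) $ a"
    using a by (simp add: dims)
  finally show "((E' - E) *\<^sub>v x - lincomb_vec k r l ?D x) $ a
      = ((E' *\<^sub>v x - lincomb_vec k r l F' x) - (E *\<^sub>v x - lincomb_vec k r l F x)) $ a" .
qed

section \<open>Comparison of the two infima\<close>

lemma vec_norm2_uminus: "vec_norm2 (- v) = vec_norm2 v"
  by (simp add: vec_norm2_def)

text \<open>If \<open>T\<close> is empty, the domination hypothesis empties \<open>S\<close> as
  well, and both sides are the same \<open>Inf {}\<close>. This covers the case that some
  \<open>n i\<close> is 0, where no unit vector exists.\<close>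

lemma Inf_eq_Inf_of_subset_coinitial:
  fixes S T :: "real set"
  assumes "bdd_below S" "T \<subseteq> S" "\<And>s. s \<in> S \<Longrightarrow> \<exists>t\<in>T. t \<le> s"
  shows "Inf S = Inf T"
proof (cases "T = {}")
  case True
  then show ?thesis using assms(3) by (metis empty_iff equals0I)
next
  case False
  have "bdd_below T" using assms(1,2) by (rule bdd_below_mono)
  with False assms show ?thesis
    by (intro antisym cInf_superset_mono cInf_mono) auto
qed

theorem theorem4p1:
  fixes k :: nat
    and m n :: "nat \<Rightarrow> nat"
    and A :: "nat \<Rightarrow> complex mat"
    and B :: "nat \<Rightarrow> nat \<Rightarrow> complex mat"
  assumes "k \<ge> 1"
    and "\<forall>i\<in>{1..k}. m i \<ge> n i"
    and "mat_family k m n A B"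
  shows "theta1 k m n A B = Inf
    {(\<Sum>i=1..k. (vec_norm2 (A i *\<^sub>v x i - lincomb_vec k (m i) l (B i) (x i)))\<^sup>2)
       / (1 + (\<Sum>i=1..k. (cmod (l i))\<^sup>2))
     | l x. unit_vec_family k n x}"
proof -
  define L where "L l = 1 + (\<Sum>s=1..k. (cmod (l s))\<^sup>2)" for l :: "nat \<Rightarrow> complex"
  define res where "res l x i = A i *\<^sub>v x i - lincomb_vec k (m i) l (B i) (x i)" for l x i
  have L: "L l > 0" for l
    unfolding L_def by (intro add_pos_nonneg sum_nonneg) auto
  have A: "A i \<in> carrier_mat (m i) (n i)" if "i \<in> {1..k}" for i
    using assms(3) that by (auto simp: mat_family_def)
  have B: "B i \<in> {1..k} \<rightarrow> carrier_mat (m i) (n i)" if "i \<in> {1..k}" for i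
    using assms(3) that by (auto simp: mat_family_def)
  have res: "res l x i \<in> carrier_vec (m i)" if "i \<in> {1..k}" for l x i
    unfolding res_def
    by (rule carrier_vecI) (simp add: carrier_vecD[OF lincomb_vec_carrier[OF B[OF that]]])
  show ?thesis
    unfolding theta1_def L_def[symmetric] res_def[symmetric]
  proof (rule Inf_eq_Inf_of_subset_coinitial, goal_cases)
    case 1
    show ?case
      by (rule bdd_belowI[of _ 0]) (auto intro: sum_nonneg)
  next
    \<comment> \<open>Every value of the quotient is the cost of a feasible point with the same
      \<open>l\<close> and \<open>x\<close>, namely the rank-one perturbation with
      \<open>y = - res l x i\<close>.\<close>
    case 2
    show ?case
    proof (rule subsetI, clarify)
      fix l :: "nat \<Rightarrow> complex" and x
      assume x: "unit_vec_family k n x"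
      define E where "E i = mat (m i) (n i)
        (\<lambda>(a, j). (- res l x i) $ a * cnj (x i $ j) / of_real (L l))" for i
      define F where "F i s = mat (m i) (n i)
        (\<lambda>(a, j). - cnj (l s) * (- res l x i) $ a * cnj (x i $ j) / of_real (L l))" for i s
      define A' where "A' i = A i + E i" for i
      define B' where "B' i s = B i s + F i s" for i s
      have fam: "mat_family k m n A' B'"
        using A B by (auto simp: mat_family_def A'_def B'_def E_def F_def)
      have sol: "A' i *\<^sub>v x i = lincomb_vec k (m i) l (B' i) (x i)"
        and cost: "(frobenius_norm (hconcat (m i)
            ((A' i - A i) # map (\<lambda>s. B' i s - B i s) [1..<Suc k])))\<^sup>2
          = (vec_norm2 (res l x i))\<^sup>2 / L l" if i: "i \<in> {1..k}" for i
      proof -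
        have xi: "x i \<in> carrier_vec (n i)" "vec_norm2 (x i) = 1"
          using x i by (auto simp: unit_vec_family_def)
        have carr: "A' i \<in> carrier_mat (m i) (n i)"
          "B' i \<in> {1..k} \<rightarrow> carrier_mat (m i) (n i)"
          using fam i by (auto simp: mat_family_def)
        have dA: "A' i - A i = E i"
          using A[OF i] by (auto simp: A'_def E_def intro!: eq_matI)
        have dB: "B' i s - B i s = F i s" if "s \<in> {1..k}" for s
          using funcset_mem[OF B[OF i] that] by (auto simp: B'_def F_def intro!: eq_matI)
        have y: "- res l x i \<in> carrier_vec (m i)"
          using res[OF i] by simp
        note rank_one = rank_one_perturbation[OF xi y, where l = l and k = k,
            folded L_def, folded E_def F_def]
        \<comment> \<open>The differences are known to equal \<open>F i s\<close> only for
          \<open>s\<close> in \<open>{1..k}\<close>, hence a congruence instead of rewriting the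
          function.\<close>
        have "lincomb_vec k (m i) l (\<lambda>s. B' i s - B i s) (x i) = lincomb_vec k (m i) l (F i) (x i)"
          by (rule lincomb_vec_cong) (auto simp: dB F_def)
        \<comment> \<open>The perturbed residual minus the original one is
          \<open>- res l x i\<close>; cancelling entrywise below makes the perturbed residual
          zero.\<close>
        then have diff: "(A' i *\<^sub>v x i - lincomb_vec k (m i) l (B' i) (x i)) - res l x i
            = - res l x i"
          using residual_diff[OF A[OF i] carr(1) B[OF i] carr(2) xi(1), of l] rank_one(1)
          by (simp add: dA res_def)
        have dims: "dim_vec (A' i *\<^sub>v x i) = m i" "dim_vec (res l x i) = m i"
          "dim_vec (lincomb_vec k (m i) l (B' i) (x i)) = m i"
          using carr(1) res[OF i] lincomb_vec_carrier[OF carr(2)] by auto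
        show "A' i *\<^sub>v x i = lincomb_vec k (m i) l (B' i) (x i)"
        proof (rule eq_vecI)
          fix a assume "a < dim_vec (lincomb_vec k (m i) l (B' i) (x i))"
          then show "(A' i *\<^sub>v x i) $ a = lincomb_vec k (m i) l (B' i) (x i) $ a"
            using arg_cong[OF diff, of "\<lambda>v. v $ a"] dims
            by (simp del: index_mult_mat_vec dim_mult_mat_vec)
        qed (use dims in simp)
        have "map (\<lambda>s. B' i s - B i s) [1..<Suc k] = map (F i) [1..<Suc k]"
          by (rule map_cong) (use dB in auto)
        then show "(frobenius_norm (hconcat (m i)
            ((A' i - A i) # map (\<lambda>s. B' i s - B i s) [1..<Suc k])))\<^sup>2
          = (vec_norm2 (res l x i))\<^sup>2 / L l"
          using rank_one(2) by (simp only: dA vec_norm2_uminus)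
      qed
      have "(\<Sum>i=1..k. (vec_norm2 (res l x i))\<^sup>2) / L l
          = (\<Sum>i=1..k. (frobenius_norm (hconcat (m i)
              ((A' i - A i) # map (\<lambda>s. B' i s - B i s) [1..<Suc k])))\<^sup>2)"
        unfolding sum_divide_distrib by (rule sum.cong) (use cost in auto)
      with fam x sol
      show "\<exists>A' B' la xa. (\<Sum>i=1..k. (vec_norm2 (res l x i))\<^sup>2) / L l
          = (\<Sum>i=1..k. (frobenius_norm (hconcat (m i)
              ((A' i - A i) # map (\<lambda>s. B' i s - B i s) [1..<Suc k])))\<^sup>2)
        \<and> mat_family k m n A' B' \<and> unit_vec_family k n xa
        \<and> (\<forall>i\<in>{1..k}. A' i *\<^sub>v xa i = lincomb_vec k (m i) la (B' i) (xa i))"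
        by blast
    qed
  next
    \<comment> \<open>The dominated element of the smaller set is the quotient at the same
      \<open>l\<close> and \<open>x\<close> as the given feasible point.\<close>
    case (3 c)
    then obtain A' B' l x where
      c: "c = (\<Sum>i=1..k. (frobenius_norm (hconcat (m i)
              ((A' i - A i) # map (\<lambda>s. B' i s - B i s) [1..<Suc k])))\<^sup>2)"
      and fam: "mat_family k m n A' B'" and x: "unit_vec_family k n x"
      and sol: "\<And>i. i \<in> {1..k} \<Longrightarrow> A' i *\<^sub>v x i = lincomb_vec k (m i) l (B' i) (x i)"
      by blast
    have bound: "(vec_norm2 (res l x i))\<^sup>2 / L l \<le> (frobenius_norm (hconcat (m i)
        ((A' i - A i) # map (\<lambda>s. B' i s - B i s) [1..<Suc k])))\<^sup>2" if i: "i \<in> {1..k}" for i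
    proof -
      have xi: "x i \<in> carrier_vec (n i)" "vec_norm2 (x i) = 1"
        using x i by (auto simp: unit_vec_family_def)
      have carr: "A' i \<in> carrier_mat (m i) (n i)"
        "B' i \<in> {1..k} \<rightarrow> carrier_mat (m i) (n i)"
        using fam i by (auto simp: mat_family_def)
      have "lincomb_vec k (m i) l (B' i) (x i) \<in> carrier_vec (m i)"
        by (rule lincomb_vec_carrier[OF carr(2)])
      \<comment> \<open>Feasibility makes the perturbed residual zero, so by linearity the
        perturbation alone has residual \<open>- res l x i\<close>.\<close>
      then have "(A' i - A i) *\<^sub>v x i - lincomb_vec k (m i) l (\<lambda>s. B' i s - B i s) (x i)
          = - res l x i"
        using residual_diff[OF A[OF i] carr(1) B[OF i] carr(2) xi(1), of l] sol[OF i] res[OF i]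
        by (simp add: res_def[symmetric])
      moreover have D: "(\<lambda>s. B' i s - B i s) \<in> {1..k} \<rightarrow> carrier_mat (m i) (n i)"
        using B[OF i] carr(2) by (auto intro!: minus_carrier_mat)
      ultimately have "(vec_norm2 (- res l x i))\<^sup>2 \<le> L l * (frobenius_norm (hconcat (m i)
          ((A' i - A i) # map (\<lambda>s. B' i s - B i s) [1..<Suc k])))\<^sup>2"
        using residual_norm_sq_le[OF minus_carrier_mat[OF A[OF i]] D xi, of "A' i" l]
        by (simp only: L_def)
      then show ?thesis
        using L[of l] by (simp add: vec_norm2_uminus field_simps del: upt_Suc)
    qed
    have "(\<Sum>i=1..k. (vec_norm2 (res l x i))\<^sup>2) / L l \<le> c"
      unfolding c sum_divide_distrib using bound by (rule sum_mono)
    with x show ?case by blast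
  qed
qed

end
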